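(* There exist a Hilbert space $\mathcal{H}$ and two closed subspaces $U,V\subseteq\mathcal{H}$ with $U\cap V=\{0\}$ such that for every $\alpha>1/2$ there exists $z^0\in\mathcal{H}$ such that if $(z^j)_{j\ge0}$ is generated by $z^{k+1}=Tz^k$ with $T=(T_{\mathrm{PRS}})_{1/2}$ applied to $f=\iota_V$ and $g=\iota_U$, then for all $k\ge1$, $$\|Tz^k-z^k\|^2\ge\frac{1}{(k+1)^{2\alpha}}.$$
   Context: $\iota_C$ is the indicator function of $C$ ($0$ on $C$, $+\infty$ off $C$). For $\gamma>0$, $\mathbf{prox}_{\gamma f}(x):=\arg\min_{y\in\mathcal{H}}f(y)+\frac{1}{2\gamma}\|y-x\|^2$, $\mathbf{refl}_{\gamma f}:=2\mathbf{prox}_{\gamma f}-I_{\mathcal{H}}$, $T_{\mathrm{PRS}}:=\mathbf{refl}_{\gamma f}\circ\mathbf{refl}_{\gamma g}$, $(T_{\mathrm{PRS}})_{1/2}:=\frac12(I_{\mathcal{H}}+T_{\mathrm{PRS}})$. For indicator functions of closed subspaces the prox is the orthogonal projection, independent of $\gamma$. *)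

theory Defs
  imports "HOL-Analysis.Analysis" "HOL-Algebra.Module"
begin

text \<open>
  The Hilbert space itself is existentially quantified, so it has to be an object rather than a
  type of class \<open>real_inner\<close>: it is a module, in the sense of HOL-Algebra, over the real field,
  together with an inner product. The ring multiplication inherited from the record type of modules
  plays no role.
\<close>

definition real_field :: "real ring" where
  "real_field = \<lparr>carrier = UNIV, monoid.mult = (*), one = 1, ring.zero = 0, add = (+)\<rparr>"

record 'a inner_space = "(real, 'a) module" +
  inner_prod :: "'a \<Rightarrow> 'a \<Rightarrow> real"

definition hnorm :: "('a, 'b) inner_space_scheme \<Rightarrow> 'a \<Rightarrow> real" where
  "hnorm H x = sqrt (inner_prod H x x)"

text \<open>
  The locale \<^locale>\<open>Metric_space\<close> demands nonnegativity and symmetry on the whole type; hence the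
  value 0 off the carrier.
\<close>

definition hdist :: "('a, 'b) inner_space_scheme \<Rightarrow> 'a \<Rightarrow> 'a \<Rightarrow> real" where
  "hdist H x y = (if x \<in> carrier H \<and> y \<in> carrier H then hnorm H (x \<ominus>\<^bsub>H\<^esub> y) else 0)"

locale inner_product_space =
  Module.module real_field H for H :: "('a, 'b) inner_space_scheme" (structure) +
  assumes inner_prod_commute:
      "\<lbrakk>x \<in> carrier H; y \<in> carrier H\<rbrakk> \<Longrightarrow> inner_prod H x y = inner_prod H y x"
    and inner_prod_add_left:
      "\<lbrakk>x \<in> carrier H; y \<in> carrier H; z \<in> carrier H\<rbrakk>
        \<Longrightarrow> inner_prod H (x \<oplus>\<^bsub>H\<^esub> y) z = inner_prod H x z + inner_prod H y z"
    and inner_prod_smult_left: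
      "\<lbrakk>x \<in> carrier H; y \<in> carrier H\<rbrakk> \<Longrightarrow> inner_prod H (a \<odot>\<^bsub>H\<^esub> x) y = a * inner_prod H x y"
    and inner_prod_pos: "\<lbrakk>x \<in> carrier H; x \<noteq> \<zero>\<^bsub>H\<^esub>\<rbrakk> \<Longrightarrow> inner_prod H x x > 0"
begin

lemma scalar [simp]: "a \<in> carrier real_field"
  by (simp add: real_field_def)

lemma minus_eq_smult: "x \<in> carrier H \<Longrightarrow> \<ominus>\<^bsub>H\<^esub> x = (-1) \<odot>\<^bsub>H\<^esub> x"
proof -
  assume x: "x \<in> carrier H"
  have "(-1) \<odot>\<^bsub>H\<^esub> x \<oplus>\<^bsub>H\<^esub> x = (-1) \<odot>\<^bsub>H\<^esub> x \<oplus>\<^bsub>H\<^esub> 1 \<odot>\<^bsub>H\<^esub> x"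
    using smult_one[OF x] by (simp add: real_field_def)
  also have "\<dots> = 0 \<odot>\<^bsub>H\<^esub> x"
    using smult_l_distr[of "-1" 1 x] x by (simp add: real_field_def)
  also have "\<dots> = \<zero>\<^bsub>H\<^esub>"
    using smult_l_null[OF x] by (simp add: real_field_def)
  finally show ?thesis
    using x by (metis M.minus_equality scalar smult_closed)
qed

lemma inner_prod_add_right:
  "\<lbrakk>x \<in> carrier H; y \<in> carrier H; z \<in> carrier H\<rbrakk>
    \<Longrightarrow> inner_prod H z (x \<oplus>\<^bsub>H\<^esub> y) = inner_prod H z x + inner_prod H z y"
  by (simp add: inner_prod_commute[of z] inner_prod_add_left)

lemma inner_prod_smult_right:
  "\<lbrakk>x \<in> carrier H; y \<in> carrier H\<rbrakk> \<Longrightarrow> inner_prod H y (a \<odot>\<^bsub>H\<^esub> x) = a * inner_prod H y x"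
  by (simp add: inner_prod_commute[of y] inner_prod_smult_left)

lemma inner_prod_zero [simp]: "inner_prod H \<zero>\<^bsub>H\<^esub> \<zero>\<^bsub>H\<^esub> = 0"
  using inner_prod_smult_left[of "\<zero>\<^bsub>H\<^esub>" "\<zero>\<^bsub>H\<^esub>" 0] by simp

lemma inner_prod_nonneg: "x \<in> carrier H \<Longrightarrow> inner_prod H x x \<ge> 0"
  using inner_prod_pos[of x] by (cases "x = \<zero>\<^bsub>H\<^esub>") auto

lemma inner_prod_eq_zero_iff: "x \<in> carrier H \<Longrightarrow> inner_prod H x x = 0 \<longleftrightarrow> x = \<zero>\<^bsub>H\<^esub>"
  using inner_prod_pos[of x] by (metis inner_prod_zero less_irrefl)

lemma Cauchy_Schwarz:
  assumes x: "x \<in> carrier H" and y: "y \<in> carrier H"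
  shows "inner_prod H x y \<le> hnorm H x * hnorm H y"
proof (cases "y = \<zero>\<^bsub>H\<^esub>")
  case True
  have "inner_prod H x \<zero>\<^bsub>H\<^esub> = 0"
    using inner_prod_smult_right[of "\<zero>\<^bsub>H\<^esub>" x 0] x by simp
  with True show ?thesis by (simp add: hnorm_def)
next
  case False
  let ?p = "inner_prod H x y" and ?q = "inner_prod H y y" and ?r = "inner_prod H x x"
  have q: "?q > 0" using False y inner_prod_pos by blast
  define t where "t = - ?p / ?q"
  have "0 \<le> inner_prod H (x \<oplus>\<^bsub>H\<^esub> t \<odot>\<^bsub>H\<^esub> y) (x \<oplus>\<^bsub>H\<^esub> t \<odot>\<^bsub>H\<^esub> y)"
    using x y by (intro inner_prod_nonneg) simp
  also have "\<dots> = ?r + 2 * t * ?p + t\<^sup>2 * ?q"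
    using x y
    by (simp add: inner_prod_add_left inner_prod_add_right inner_prod_smult_left
        inner_prod_smult_right inner_prod_commute[of y x] power2_eq_square algebra_simps)
  also have "\<dots> = ?r - ?p\<^sup>2 / ?q"
    using q by (simp add: t_def field_simps power2_eq_square)
  finally have "?p\<^sup>2 \<le> ?r * ?q"
    using q by (simp add: field_simps)
  then have "\<bar>?p\<bar> \<le> sqrt (?r * ?q)"
    by (metis real_sqrt_abs real_sqrt_le_mono)
  then show ?thesis by (simp add: hnorm_def real_sqrt_mult)
qed

lemma hnorm_triangle:
  assumes x: "x \<in> carrier H" and y: "y \<in> carrier H"
  shows "hnorm H (x \<oplus>\<^bsub>H\<^esub> y) \<le> hnorm H x + hnorm H y"
proof -
  have sq: "(hnorm H z)\<^sup>2 = inner_prod H z z" if "z \<in> carrier H" for z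
    using inner_prod_nonneg[OF that] by (simp add: hnorm_def)
  have "(hnorm H (x \<oplus>\<^bsub>H\<^esub> y))\<^sup>2 = (hnorm H x)\<^sup>2 + (hnorm H y)\<^sup>2 + 2 * inner_prod H x y"
    using x y by (simp add: sq inner_prod_add_left inner_prod_add_right inner_prod_commute[of y x])
  also have "\<dots> \<le> (hnorm H x + hnorm H y)\<^sup>2"
    using Cauchy_Schwarz[OF x y] by (simp add: power2_sum)
  finally show ?thesis
    by (rule power2_le_imp_le) (use x y in \<open>simp add: hnorm_def inner_prod_nonneg\<close>)
qed

lemma hnorm_minus: "x \<in> carrier H \<Longrightarrow> hnorm H (\<ominus>\<^bsub>H\<^esub> x) = hnorm H x"
  by (simp add: hnorm_def minus_eq_smult inner_prod_smult_left inner_prod_smult_right)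

sublocale metric: Metric_space "carrier H" "hdist H"
proof
  show "0 \<le> hdist H x y" for x y
    by (simp add: hdist_def hnorm_def inner_prod_nonneg)
  show "hdist H x y = hdist H y x" for x y
  proof (cases "x \<in> carrier H \<and> y \<in> carrier H")
    case True
    then have "\<ominus>\<^bsub>H\<^esub> (x \<ominus>\<^bsub>H\<^esub> y) = y \<ominus>\<^bsub>H\<^esub> x"
      by (simp add: a_minus_def M.minus_add M.a_comm)
    then show ?thesis
      using True hnorm_minus[of "x \<ominus>\<^bsub>H\<^esub> y"] by (simp add: hdist_def)
  qed (auto simp: hdist_def)
  show "hdist H x y = 0 \<longleftrightarrow> x = y" if "x \<in> carrier H" "y \<in> carrier H" for x y
  proof -
    have "x \<ominus>\<^bsub>H\<^esub> y = \<zero>\<^bsub>H\<^esub> \<longleftrightarrow> x = y"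
      using that by (metis M.a_inv_closed M.minus_equality M.minus_minus M.r_neg a_minus_def)
    then show ?thesis
      using that by (simp add: hdist_def hnorm_def inner_prod_eq_zero_iff)
  qed
  show "hdist H x z \<le> hdist H x y + hdist H y z"
    if "x \<in> carrier H" "y \<in> carrier H" "z \<in> carrier H" for x y z
  proof -
    have "(x \<ominus>\<^bsub>H\<^esub> y) \<oplus>\<^bsub>H\<^esub> (y \<ominus>\<^bsub>H\<^esub> z) = x \<ominus>\<^bsub>H\<^esub> z"
      using that by (simp add: a_minus_def M.a_assoc M.r_neg1)
    then show ?thesis
      using that hnorm_triangle[of "x \<ominus>\<^bsub>H\<^esub> y" "y \<ominus>\<^bsub>H\<^esub> z"] by (simp add: hdist_def)
  qed
qed

end

locale hilbert_space = inner_product_space +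
  assumes complete: "Metric_space.mcomplete (carrier H) (hdist H)"

definition closed_subspace :: "('a, 'b) inner_space_scheme \<Rightarrow> 'a set \<Rightarrow> bool" where
  "closed_subspace H U \<longleftrightarrow>
     submodule U real_field H \<and>
     closedin (Metric_space.mtopology (carrier H) (hdist H)) U"

definition indicator_fn :: "'a set \<Rightarrow> 'a \<Rightarrow> ereal" where
  "indicator_fn C x = (if x \<in> C then 0 else \<infinity>)"

definition prox :: "('a, 'b) inner_space_scheme \<Rightarrow> real \<Rightarrow> ('a \<Rightarrow> ereal) \<Rightarrow> 'a \<Rightarrow> 'a" where
  "prox H \<gamma> f x =
     arg_min_on (\<lambda>y. f y + ereal (1 / (2 * \<gamma>) * (hnorm H (y \<ominus>\<^bsub>H\<^esub> x))\<^sup>2)) (carrier H)"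

definition prox_refl :: "('a, 'b) inner_space_scheme \<Rightarrow> real \<Rightarrow> ('a \<Rightarrow> ereal) \<Rightarrow> 'a \<Rightarrow> 'a" where
  "prox_refl H \<gamma> f x = 2 \<odot>\<^bsub>H\<^esub> prox H \<gamma> f x \<ominus>\<^bsub>H\<^esub> x"

definition T_PRS ::
  "('a, 'b) inner_space_scheme \<Rightarrow> real \<Rightarrow> ('a \<Rightarrow> ereal) \<Rightarrow> ('a \<Rightarrow> ereal) \<Rightarrow> 'a \<Rightarrow> 'a" where
  "T_PRS H \<gamma> f g = prox_refl H \<gamma> f \<circ> prox_refl H \<gamma> g"

definition half_averaged :: "('a, 'b) inner_space_scheme \<Rightarrow> ('a \<Rightarrow> 'a) \<Rightarrow> 'a \<Rightarrow> 'a" where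
  "half_averaged H S x = (1 / 2) \<odot>\<^bsub>H\<^esub> (x \<oplus>\<^bsub>H\<^esub> S x)"

end

theory Submission
  imports Defs
begin

text \<open>
  In \<open>\<ell>\<^sup>2\<close>, pair the coordinates \<open>2i\<close> and \<open>2i+1\<close> and let \<open>U\<close> and \<open>V\<close> meet the \<open>i\<close>-th plane in two
  lines at angle \<open>\<theta>\<^sub>i\<close>. There \<open>T\<close> is \<open>cos \<theta>\<^sub>i\<close> times the rotation by \<open>\<theta>\<^sub>i\<close>, and \<open>T - I\<close> is \<open>sin \<theta>\<^sub>i\<close>
  times an isometry, so the squared residual after \<open>k\<close> steps is the sum over \<open>i\<close> of
  \<open>sin\<^sup>2 \<theta>\<^sub>i * cos\<^sup>2\<^sup>k \<theta>\<^sub>i * w\<^sub>i\<close>, where \<open>w\<^sub>i\<close> is the squared norm of the \<open>i\<close>-th component of the starting point.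
  With \<open>sin\<^sup>2 \<theta>\<^sub>i = 1 / 2\<^sup>i\<^sup>+\<^sup>1\<close> and \<open>w\<^sub>i\<close> proportional to \<open>(2\<^sup>i) powr (1 - 2 * \<alpha>)\<close>, which is summable for
  \<open>\<alpha> > 1/2\<close>, the single term with \<open>2\<^sup>i \<le> k + 1 < 2\<^sup>i\<^sup>+\<^sup>1\<close> already suffices: its factor
  \<open>cos\<^sup>2\<^sup>k \<theta>\<^sub>i\<close> is at least \<open>1/4\<close> by Bernoulli's inequality.
\<close>

section \<open>Projections in inner product spaces\<close>

context inner_product_space
begin

lemma inner_prod_diff_left:
  "\<lbrakk>x \<in> carrier H; y \<in> carrier H; z \<in> carrier H\<rbrakk>
    \<Longrightarrow> inner_prod H (x \<ominus>\<^bsub>H\<^esub> y) z = inner_prod H x z - inner_prod H y z"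
  by (simp add: a_minus_def minus_eq_smult inner_prod_add_left inner_prod_smult_left)

lemma inner_prod_diff_right:
  "\<lbrakk>x \<in> carrier H; y \<in> carrier H; z \<in> carrier H\<rbrakk>
    \<Longrightarrow> inner_prod H z (x \<ominus>\<^bsub>H\<^esub> y) = inner_prod H z x - inner_prod H z y"
  by (simp add: a_minus_def minus_eq_smult inner_prod_add_right inner_prod_smult_right)

lemma abs_inner_prod_le:
  assumes "x \<in> carrier H" "y \<in> carrier H"
  shows "\<bar>inner_prod H x y\<bar> \<le> hnorm H x * hnorm H y"
  using Cauchy_Schwarz[of x y] Cauchy_Schwarz[of "\<ominus>\<^bsub>H\<^esub> x" y] hnorm_minus[of x] assms
  by (simp add: minus_eq_smult inner_prod_smult_left abs_le_iff)

text \<open>Closedness comes from Cauchy-Schwarz: if \<open>x\<close> has nonzero inner product with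
  some \<open>v\<close> in \<open>S\<close>, so has every point close enough to \<open>x\<close>.
  Both subspaces below are cut out by countably many such equations.\<close>

lemma closed_subspace_orthogonal:
  assumes S: "S \<subseteq> carrier H"
  shows "closed_subspace H {x \<in> carrier H. \<forall>v\<in>S. inner_prod H x v = 0}" (is "closed_subspace H ?C")
  unfolding closed_subspace_def
proof
  have zero: "inner_prod H \<zero>\<^bsub>H\<^esub> v = 0" if "v \<in> carrier H" for v
    using inner_prod_smult_left[of "\<zero>\<^bsub>H\<^esub>" v 0] that by simp
  show "submodule ?C real_field H"
    using S zero by (intro submoduleI)
      (auto simp: minus_eq_smult inner_prod_add_left inner_prod_smult_left subset_iff)
  show "closedin metric.mtopology ?C"
    unfolding metric.closedin_metric
  proof (intro conjI allI impI)
    fix x assume x: "x \<in> carrier H - ?C"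
    then obtain v where v: "v \<in> S" "inner_prod H x v \<noteq> 0" by auto
    with S have vH: "v \<in> carrier H" by auto
    \<comment> \<open>The \<open>+ 1\<close> makes \<open>r * hnorm H v\<close> strictly smaller
      than the absolute inner product.\<close>
    define r where "r = \<bar>inner_prod H x v\<bar> / (hnorm H v + 1)"
    have nn: "hnorm H v \<ge> 0" by (simp add: hnorm_def inner_prod_nonneg vH)
    have r: "r > 0" using v nn by (simp add: r_def)
    have "disjnt ?C (metric.mball x r)"
    proof (rule ccontr)
      assume "\<not> ?thesis"
      then obtain y where y: "y \<in> ?C" "y \<in> carrier H" "hdist H x y < r"
        by (auto simp: disjnt_iff)
      have "\<bar>inner_prod H x v\<bar> = \<bar>inner_prod H (x \<ominus>\<^bsub>H\<^esub> y) v\<bar>"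
        using x y v vH by (simp add: inner_prod_diff_left)
      also have "\<dots> \<le> hnorm H (x \<ominus>\<^bsub>H\<^esub> y) * hnorm H v"
        using x y vH by (intro abs_inner_prod_le) auto
      also have "hnorm H (x \<ominus>\<^bsub>H\<^esub> y) \<le> r"
        using x y by (simp add: hdist_def)
      also have "r * hnorm H v < r * (hnorm H v + 1)" using r by simp
      also have "\<dots> = \<bar>inner_prod H x v\<bar>" using nn by (simp add: r_def)
      finally show False using nn by (simp add: mult_right_mono)
    qed
    with r show "\<exists>r>0. disjnt ?C (metric.mball x r)" by blast
  qed auto
qed

text \<open>By Pythagoras, a point \<open>p\<close> of \<open>C\<close> with \<open>x - p\<close>
  orthogonal to all \<open>y - p\<close> is the strictly nearest point of \<open>C\<close> to
  \<open>x\<close>; scaling by \<gamma> does not change the minimiser.\<close>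

lemma prox_indicator_eq:
  assumes C: "C \<subseteq> carrier H" and p: "p \<in> C" and x: "x \<in> carrier H" and "\<gamma> > 0"
    and orth: "\<And>y. y \<in> C \<Longrightarrow> inner_prod H (y \<ominus>\<^bsub>H\<^esub> p) (x \<ominus>\<^bsub>H\<^esub> p) = 0"
  shows "prox H \<gamma> (indicator_fn C) x = p"
proof -
  let ?f = "\<lambda>y. indicator_fn C y + ereal (1 / (2 * \<gamma>) * (hnorm H (y \<ominus>\<^bsub>H\<^esub> x))\<^sup>2)"
  have pH: "p \<in> carrier H" using C p by auto
  have sq: "(hnorm H u)\<^sup>2 = inner_prod H u u" if "u \<in> carrier H" for u
    using inner_prod_nonneg[OF that] by (simp add: hnorm_def)
  have pyth: "(hnorm H (y \<ominus>\<^bsub>H\<^esub> x))\<^sup>2 = (hnorm H (y \<ominus>\<^bsub>H\<^esub> p))\<^sup>2 + (hnorm H (p \<ominus>\<^bsub>H\<^esub> x))\<^sup>2"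
    if "y \<in> C" for y
  proof -
    have y: "y \<in> carrier H" using C that by auto
    show ?thesis
      using orth[OF that] x y pH inner_prod_commute[OF x pH] inner_prod_commute[OF x y]
        inner_prod_commute[OF y pH]
      by (simp add: sq inner_prod_diff_left inner_prod_diff_right)
  qed
  have lt: "?f p < ?f y" if "y \<in> carrier H" "y \<noteq> p" for y
  proof (cases "y \<in> C")
    case True
    have "hdist H y p > 0" using that pH by (simp add: metric.mdist_pos_eq)
    then have "hnorm H (y \<ominus>\<^bsub>H\<^esub> p) > 0" using that pH by (simp add: hdist_def)
    then have "(hnorm H (p \<ominus>\<^bsub>H\<^esub> x))\<^sup>2 < (hnorm H (y \<ominus>\<^bsub>H\<^esub> x))\<^sup>2"
      using pyth[OF True] by simp
    then show ?thesis using True p \<open>\<gamma> > 0\<close> by (simp add: indicator_fn_def divide_strict_right_mono)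
  qed (use p in \<open>simp add: indicator_fn_def\<close>)
  \<comment> \<open>\<open>arg_min\<close> is a choice among minimisers, so uniqueness is needed to
    identify its value.\<close>
  have "is_arg_min ?f (\<lambda>y. y \<in> carrier H) q \<longleftrightarrow> q = p" for q
    unfolding is_arg_min_def using lt pH by (metis less_asym less_irrefl)
  then show ?thesis
    by (simp add: prox_def arg_min_on_def arg_min_def)
qed

end

section \<open>The space of square-summable sequences\<close>

lemma cring_real_field: "cring real_field"
  by (intro cringI abelian_groupI comm_monoidI)
     (auto simp: real_field_def algebra_simps intro: exI[of _ "- _"])

definition ell2 :: "(nat \<Rightarrow> real) inner_space" where
  "ell2 = \<lparr>carrier = {x. summable (\<lambda>n. (x n)\<^sup>2)}, monoid.mult = (\<lambda>x y. x), one = (\<lambda>_. 0),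
    ring.zero = (\<lambda>_. 0), add = (\<lambda>x y n. x n + y n), smult = (\<lambda>a x n. a * x n),
    inner_prod = (\<lambda>x y. \<Sum>n. x n * y n)\<rparr>"

lemma ell2_simps [simp]:
  "x \<in> carrier ell2 \<longleftrightarrow> summable (\<lambda>n. (x n)\<^sup>2)"
  "\<zero>\<^bsub>ell2\<^esub> = (\<lambda>_. 0)"
  "x \<oplus>\<^bsub>ell2\<^esub> y = (\<lambda>n. x n + y n)"
  "a \<odot>\<^bsub>ell2\<^esub> x = (\<lambda>n. a * x n)"
  "inner_prod ell2 x y = (\<Sum>n. x n * y n)"
  by (simp_all add: ell2_def)

lemma summable_mult_of_squares:
  fixes x y :: "nat \<Rightarrow> real"
  assumes "summable (\<lambda>n. (x n)\<^sup>2)" "summable (\<lambda>n. (y n)\<^sup>2)"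
  shows "summable (\<lambda>n. x n * y n)"
proof (rule summable_comparison_test'[OF summable_add[OF assms]])
  show "norm (x n * y n) \<le> (x n)\<^sup>2 + (y n)\<^sup>2" for n
  proof -
    have "2 * (\<bar>x n\<bar> * \<bar>y n\<bar>) \<le> (x n)\<^sup>2 + (y n)\<^sup>2"
      using sum_squares_bound[of "\<bar>x n\<bar>" "\<bar>y n\<bar>"] by (simp add: mult.assoc)
    moreover have "0 \<le> \<bar>x n\<bar> * \<bar>y n\<bar>" by simp
    ultimately show ?thesis unfolding real_norm_def abs_mult by linarith
  qed
qed

lemma summable_square_add:
  fixes x y :: "nat \<Rightarrow> real"
  assumes "summable (\<lambda>n. (x n)\<^sup>2)" "summable (\<lambda>n. (y n)\<^sup>2)"
  shows "summable (\<lambda>n. (x n + y n)\<^sup>2)"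
  unfolding power2_sum mult.assoc
  by (rule summable_add[OF summable_add[OF assms] summable_mult[OF summable_mult_of_squares[OF assms]]])

lemma summable_square_cmult:
  fixes x :: "nat \<Rightarrow> real"
  shows "summable (\<lambda>n. (x n)\<^sup>2) \<Longrightarrow> summable (\<lambda>n. (a * x n)\<^sup>2)"
  by (simp add: power_mult_distrib summable_mult)

lemma abelian_group_ell2: "abelian_group ell2"
proof (rule abelian_groupI)
  fix x assume "x \<in> carrier ell2"
  then show "\<exists>y\<in>carrier ell2. y \<oplus>\<^bsub>ell2\<^esub> x = \<zero>\<^bsub>ell2\<^esub>"
    by (intro bexI[of _ "\<lambda>n. - x n"]) auto
qed (auto simp: summable_square_add add.assoc add.commute)

lemma module_ell2: "module real_field ell2"
proof (intro module.intro module_axioms.intro cring_real_field abelian_group_ell2)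
qed (simp_all add: real_field_def summable_square_cmult distrib_left distrib_right mult.assoc)

interpretation ell2: inner_product_space ell2
proof (intro inner_product_space.intro inner_product_space_axioms.intro module_ell2)
  fix x assume x: "x \<in> carrier ell2" "x \<noteq> \<zero>\<^bsub>ell2\<^esub>"
  then obtain i where "x i \<noteq> 0" by auto
  then have "0 < (\<Sum>n. (x n)\<^sup>2)"
    using x(1) by (intro suminf_pos2[of _ i]) auto
  then show "0 < inner_prod ell2 x x"
    by (simp add: power2_eq_square)
next
  fix x y z assume "x \<in> carrier ell2" "y \<in> carrier ell2" "z \<in> carrier ell2"
  then show "inner_prod ell2 (x \<oplus>\<^bsub>ell2\<^esub> y) z = inner_prod ell2 x z + inner_prod ell2 y z"
    by (simp add: distrib_right suminf_add[symmetric] summable_mult_of_squares)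
next
  fix a x y assume "x \<in> carrier ell2" "y \<in> carrier ell2"
  then show "inner_prod ell2 (a \<odot>\<^bsub>ell2\<^esub> x) y = a * inner_prod ell2 x y"
    using suminf_mult[OF summable_mult_of_squares[of x y], of a] by (simp add: mult.assoc)
qed (simp add: mult.commute)

lemma ell2_minus [simp]:
  "y \<in> carrier ell2 \<Longrightarrow> x \<ominus>\<^bsub>ell2\<^esub> y = (\<lambda>n. x n - y n)"
  by (simp add: a_minus_def ell2.minus_eq_smult del: ell2_simps(1))

lemma hnorm_ell2: "hnorm ell2 x = sqrt (\<Sum>n. (x n)\<^sup>2)"
  by (simp add: hnorm_def power2_eq_square)

lemma hnorm_ell2_square: "x \<in> carrier ell2 \<Longrightarrow> (hnorm ell2 x)\<^sup>2 = (\<Sum>n. (x n)\<^sup>2)"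
  by (simp add: hnorm_ell2 suminf_nonneg)

section \<open>Completeness by coordinatewise limits\<close>

lemma sum_le_hnorm_ell2:
  assumes "x \<in> carrier ell2" "finite A"
  shows "(\<Sum>n\<in>A. (x n)\<^sup>2) \<le> (hnorm ell2 x)\<^sup>2"
  using assms by (simp only: hnorm_ell2_square) (simp add: sum_le_suminf)

lemma summable_square_diff:
  fixes x y :: "nat \<Rightarrow> real"
  assumes "summable (\<lambda>n. (x n)\<^sup>2)" "summable (\<lambda>n. (y n)\<^sup>2)"
  shows "summable (\<lambda>n. (x n - y n)\<^sup>2)"
  using summable_square_add[of x "\<lambda>n. - y n"] assms by simp

lemma ell2_mcomplete: "ell2.metric.mcomplete"
  unfolding ell2.metric.mcomplete_def
proof (intro allI impI)
  fix \<sigma> assume "ell2.metric.MCauchy \<sigma>"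
  then have \<sigma>: "\<And>n. \<sigma> n \<in> carrier ell2"
    and cau: "\<And>\<epsilon>. \<epsilon> > 0 \<Longrightarrow> \<exists>N. \<forall>n n'. N \<le> n \<longrightarrow> N \<le> n' \<longrightarrow> hdist ell2 (\<sigma> n) (\<sigma> n') < \<epsilon>"
    unfolding ell2.metric.MCauchy_def by blast+
  have part: "(\<Sum>j\<in>A. (\<sigma> n j - \<sigma> m j)\<^sup>2) \<le> (hdist ell2 (\<sigma> n) (\<sigma> m))\<^sup>2" if "finite A" for A n m
  proof -
    have "(\<lambda>j. \<sigma> n j - \<sigma> m j) \<in> carrier ell2"
      using \<sigma>[of n] \<sigma>[of m] by (simp add: summable_square_diff)
    from sum_le_hnorm_ell2[OF this that] show ?thesis
      using \<sigma>[of n] \<sigma>[of m] by (simp add: hdist_def)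
  qed
  have "Cauchy (\<lambda>n. \<sigma> n j)" for j
  proof (rule metric_CauchyI)
    fix e :: real assume "e > 0"
    with cau obtain N where N: "\<And>n m. N \<le> n \<Longrightarrow> N \<le> m \<Longrightarrow> hdist ell2 (\<sigma> n) (\<sigma> m) < e" by blast
    have "dist (\<sigma> n j) (\<sigma> m j) < e" if "N \<le> n" "N \<le> m" for n m
    proof -
      have "dist (\<sigma> n j) (\<sigma> m j) \<le> hdist ell2 (\<sigma> n) (\<sigma> m)"
        using part[of "{j}" n m] by (simp add: dist_real_def power2_le_iff_abs_le)
      with N[OF that] show ?thesis by simp
    qed
    then show "\<exists>M. \<forall>m\<ge>M. \<forall>n\<ge>M. dist (\<sigma> m j) (\<sigma> n j) < e" by blast
  qed
  then have "\<forall>j. \<exists>l. (\<lambda>n. \<sigma> n j) \<longlonglongrightarrow> l" by (simp add: Cauchy_convergent_iff convergent_def)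
  then obtain l where l: "\<And>j. (\<lambda>n. \<sigma> n j) \<longlonglongrightarrow> l j" by metis
  have lim: "\<exists>N. \<forall>n\<ge>N. summable (\<lambda>j. (\<sigma> n j - l j)\<^sup>2) \<and> (\<Sum>j. (\<sigma> n j - l j)\<^sup>2) \<le> e\<^sup>2"
    if e: "e > 0" for e :: real
  proof -
    obtain N where N: "\<And>n m. N \<le> n \<Longrightarrow> N \<le> m \<Longrightarrow> hdist ell2 (\<sigma> n) (\<sigma> m) < e"
      using cau[OF e] by blast
    have "summable (\<lambda>j. (\<sigma> n j - l j)\<^sup>2) \<and> (\<Sum>j. (\<sigma> n j - l j)\<^sup>2) \<le> e\<^sup>2" if n: "n \<ge> N" for n
    proof -
      \<comment> \<open>The limit in \<open>m\<close> is taken only in finite sums; as the bound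
        does not depend on \<open>A\<close>, it yields both summability and the bound on the full
        series.\<close>
      have bd: "(\<Sum>j\<in>A. (\<sigma> n j - l j)\<^sup>2) \<le> e\<^sup>2" if A: "finite A" for A
      proof (rule LIMSEQ_le_const2)
        show "(\<lambda>m. \<Sum>j\<in>A. (\<sigma> n j - \<sigma> m j)\<^sup>2) \<longlonglongrightarrow> (\<Sum>j\<in>A. (\<sigma> n j - l j)\<^sup>2)"
          by (intro tendsto_intros l)
        show "\<exists>M. \<forall>m\<ge>M. (\<Sum>j\<in>A. (\<sigma> n j - \<sigma> m j)\<^sup>2) \<le> e\<^sup>2"
        proof (intro exI[of _ N] allI impI)
          fix m assume "m \<ge> N"
          then have "(hdist ell2 (\<sigma> n) (\<sigma> m))\<^sup>2 \<le> e\<^sup>2"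
            using N[OF n, of m] by (intro power_mono) auto
          then show "(\<Sum>j\<in>A. (\<sigma> n j - \<sigma> m j)\<^sup>2) \<le> e\<^sup>2" using part[OF A, of n m] by linarith
        qed
      qed
      then have "summable (\<lambda>j. (\<sigma> n j - l j)\<^sup>2)"
        by (intro bounded_imp_summable[where B = "e\<^sup>2"]) auto
      moreover from this have "(\<Sum>j. (\<sigma> n j - l j)\<^sup>2) \<le> e\<^sup>2"
        by (rule suminf_le_const) (simp add: bd)
      ultimately show ?thesis by blast
    qed
    then show ?thesis by blast
  qed
  obtain N where "summable (\<lambda>j. (\<sigma> N j - l j)\<^sup>2)" using lim[of 1] by auto
  \<comment> \<open>\<open>l\<close> is the difference of \<open>\<sigma> N\<close> and
    \<open>\<sigma> N - l\<close>, both square-summable.\<close>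
  from summable_square_diff[OF _ this, of "\<sigma> N"] \<sigma>[of N] have lH: "l \<in> carrier ell2" by simp
  have "limitin ell2.metric.mtopology \<sigma> l sequentially"
    unfolding ell2.metric.limit_metric_sequentially
  proof (intro conjI lH allI impI)
    fix e :: real assume e: "e > 0"
    \<comment> \<open>Halving \<open>e\<close> recovers a strict inequality from the non-strict
      bound of \<open>lim\<close>.\<close>
    then obtain N where N: "\<And>n. n \<ge> N \<Longrightarrow> (\<Sum>j. (\<sigma> n j - l j)\<^sup>2) \<le> (e/2)\<^sup>2"
      using lim[of "e/2"] by auto
    have "\<sigma> n \<in> carrier ell2 \<and> hdist ell2 (\<sigma> n) l < e" if "n \<ge> N" for n
    proof -
      have "hdist ell2 (\<sigma> n) l \<le> e / 2"
        using \<sigma>[of n] lH real_sqrt_le_mono[OF N[OF that]] e by (simp add: hdist_def hnorm_ell2)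
      with e \<sigma>[of n] show ?thesis by simp
    qed
    then show "\<exists>N. \<forall>n\<ge>N. \<sigma> n \<in> carrier ell2 \<and> hdist ell2 (\<sigma> n) l < e" by blast
  qed
  then show "\<exists>x. limitin ell2.metric.mtopology \<sigma> x sequentially" by blast
qed

lemma hilbert_space_ell2: "hilbert_space ell2"
  by (intro hilbert_space.intro hilbert_space_axioms.intro ell2_mcomplete
      ell2.inner_product_space_axioms)

section \<open>Regrouping series by coordinate pairs\<close>

lemma inner_prod_ell2_pairs:
  assumes "x \<in> carrier ell2" "y \<in> carrier ell2"
  shows "inner_prod ell2 x y = (\<Sum>i. x (2*i) * y (2*i) + x (2*i+1) * y (2*i+1))"
proof -
  have "(\<lambda>n. x n * y n) sums inner_prod ell2 x y"
    using assms by (simp add: summable_sums summable_mult_of_squares)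
  from sums_group[OF this, of 2] show ?thesis
    by (simp add: sums_iff mult.commute[of _ 2])
qed

text \<open>The comparison holds per pair and not per coordinate, so partial sums are first extended
  to an even number of terms.\<close>

lemma summable_square_pairs:
  fixes x y :: "nat \<Rightarrow> real"
  assumes x: "summable (\<lambda>n. (x n)\<^sup>2)"
    and le: "\<And>i. (y (2*i))\<^sup>2 + (y (2*i+1))\<^sup>2 \<le> (x (2*i))\<^sup>2 + (x (2*i+1))\<^sup>2"
  shows "summable (\<lambda>n. (y n)\<^sup>2)"
proof (rule bounded_imp_summable)
  fix n
  have pair: "(\<Sum>k<2*m. f k) = (\<Sum>i<m. f (2*i) + f (2*i+1))" for m and f :: "nat \<Rightarrow> real"
    by (induction m) auto
  have "(\<Sum>k\<le>n. (y k)\<^sup>2) \<le> (\<Sum>k<2 * Suc n. (y k)\<^sup>2)"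
    by (intro sum_mono2) auto
  also have "\<dots> \<le> (\<Sum>k<2 * Suc n. (x k)\<^sup>2)"
    unfolding pair by (intro sum_mono le)
  also have "\<dots> \<le> (\<Sum>k. (x k)\<^sup>2)"
    by (intro sum_le_suminf x) auto
  finally show "(\<Sum>k\<le>n. (y k)\<^sup>2) \<le> (\<Sum>k. (x k)\<^sup>2)" .
qed auto

section \<open>Two subspaces made of lines in orthogonal planes\<close>

definition on_pairs ::
  "(nat \<Rightarrow> real \<Rightarrow> real \<Rightarrow> real) \<Rightarrow> (nat \<Rightarrow> real \<Rightarrow> real \<Rightarrow> real) \<Rightarrow> (nat \<Rightarrow> real) \<Rightarrow> nat \<Rightarrow> real" where
  "on_pairs f g x n = (let i = n div 2 in (if even n then f else g) i (x (2*i)) (x (2*i+1)))"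

lemma on_pairs_simps [simp]:
  "on_pairs f g x (2*i) = f i (x (2*i)) (x (2*i+1))"
  "on_pairs f g x (Suc (2*i)) = g i (x (2*i)) (x (2*i+1))"
  by (simp_all add: on_pairs_def)

lemma pairs_eqI:
  assumes "\<And>i. x (2*i) = y (2*i)" "\<And>i. x (Suc (2*i)) = y (Suc (2*i))"
  shows "x = (y :: nat \<Rightarrow> real)"
proof
  show "x n = y n" for n
    using assms by (cases "even n") (auto elim!: evenE oddE)
qed

locale plane_lines =
  fixes c s :: "nat \<Rightarrow> real"
  assumes unit: "(c i)\<^sup>2 + (s i)\<^sup>2 = 1"
begin

definition U :: "(nat \<Rightarrow> real) set" where
  "U = {x \<in> carrier ell2. \<forall>i. x (2*i+1) = 0}"

text \<open>In each plane this is the line spanned by \<open>(c i, s i)\<close>, given by its normal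
  \<open>(s i, - c i)\<close> so that closedness follows from orthogonality.\<close>

definition V :: "(nat \<Rightarrow> real) set" where
  "V = {x \<in> carrier ell2. \<forall>i. s i * x (2*i) = c i * x (2*i+1)}"

definition PU :: "(nat \<Rightarrow> real) \<Rightarrow> nat \<Rightarrow> real" where
  "PU = on_pairs (\<lambda>i a b. a) (\<lambda>i a b. 0)"

definition PV :: "(nat \<Rightarrow> real) \<Rightarrow> nat \<Rightarrow> real" where
  "PV = on_pairs (\<lambda>i a b. c i * (c i * a + s i * b)) (\<lambda>i a b. s i * (c i * a + s i * b))"

text \<open>On the \<open>i\<close>-th plane this is \<open>c i\<close> times the rotation with
  cosine \<open>c i\<close> and sine \<open>s i\<close>, the closed form of the averaged
  operator.\<close>

definition step :: "(nat \<Rightarrow> real) \<Rightarrow> nat \<Rightarrow> real" where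
  "step = on_pairs (\<lambda>i a b. c i * (c i * a - s i * b)) (\<lambda>i a b. c i * (s i * a + c i * b))"

lemma pair_maps_simps:
  "PU x (2*i) = x (2*i)"
  "PU x (Suc (2*i)) = 0"
  "PV x (2*i) = c i * (c i * x (2*i) + s i * x (Suc (2*i)))"
  "PV x (Suc (2*i)) = s i * (c i * x (2*i) + s i * x (Suc (2*i)))"
  "step x (2*i) = c i * (c i * x (2*i) - s i * x (Suc (2*i)))"
  "step x (Suc (2*i)) = c i * (s i * x (2*i) + c i * x (Suc (2*i)))"
  by (simp_all add: PU_def PV_def step_def)

lemma closed_subspace_pair_functional:
  "closed_subspace ell2 {x \<in> carrier ell2. \<forall>i. a i * x (2*i) + b i * x (2*i+1) = 0}"
proof -
  \<comment> \<open>The \<open>i\<close>-th equation says that \<open>x\<close> is orthogonal to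
    this vector, which is supported on a single pair.\<close>
  define v where "v i = (\<lambda>n. if n = 2*i then a i else if n = 2*i+1 then b i else 0)" for i
  have v: "v i \<in> carrier ell2" for i
    by (auto intro!: summable_finite[of "{2*i,2*i+1}"] simp: v_def split: if_splits)
  have "inner_prod ell2 x (v i) = a i * x (2*i) + b i * x (2*i+1)" for x i
  proof -
    have "inner_prod ell2 x (v i) = (\<Sum>n\<in>{2*i,2*i+1}. x n * v i n)"
      by (simp only: ell2_simps, rule suminf_finite) (auto simp: v_def split: if_splits)
    then show ?thesis by (simp add: v_def mult.commute)
  qed
  with ell2.closed_subspace_orthogonal[of "range v"] v show ?thesis
    by (auto simp del: ell2_simps)
qed

lemma closed_subspace_U: "closed_subspace ell2 U"
  using closed_subspace_pair_functional[of "\<lambda>_. 0" "\<lambda>_. 1"] by (simp add: U_def)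

lemma closed_subspace_V: "closed_subspace ell2 V"
  using closed_subspace_pair_functional[of s "\<lambda>i. - c i"] by (simp add: V_def)

lemma U_Int_V:
  assumes "\<And>i. s i \<noteq> 0"
  shows "U \<inter> V = {\<zero>\<^bsub>ell2\<^esub>}"
proof
  show "U \<inter> V \<subseteq> {\<zero>\<^bsub>ell2\<^esub>}"
    using assms by (auto simp: U_def V_def intro!: pairs_eqI)
qed (auto simp: U_def V_def)

lemma PU_in_U: "x \<in> carrier ell2 \<Longrightarrow> PU x \<in> U"
  by (auto simp: U_def pair_maps_simps intro!: summable_square_pairs[of x])

lemma PV_in_V: "x \<in> carrier ell2 \<Longrightarrow> PV x \<in> V"
proof -
  assume x: "x \<in> carrier ell2"
  have "(PV x (2*i))\<^sup>2 + (PV x (2*i+1))\<^sup>2 \<le> (x (2*i))\<^sup>2 + (x (2*i+1))\<^sup>2" for i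
  proof -
    let ?a = "x (2*i)" and ?b = "x (2*i+1)"
    have "(PV x (2*i))\<^sup>2 + (PV x (2*i+1))\<^sup>2 = ((c i)\<^sup>2 + (s i)\<^sup>2) * (c i * ?a + s i * ?b)\<^sup>2"
      by (simp add: pair_maps_simps power_mult_distrib distrib_right)
    \<comment> \<open>The added square is that of the component along the normal; with it, the
      identity of Lagrange gives the full squared norm of the pair.\<close>
    also have "\<dots> \<le> (c i * ?a + s i * ?b)\<^sup>2 + (s i * ?a - c i * ?b)\<^sup>2"
      by (simp add: unit)
    also have "\<dots> = ((c i)\<^sup>2 + (s i)\<^sup>2) * (?a\<^sup>2 + ?b\<^sup>2)"
      by (simp add: power2_eq_square algebra_simps)
    finally show ?thesis by (simp add: unit)
  qed
  with x show "PV x \<in> V"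
    by (auto simp: V_def pair_maps_simps intro!: summable_square_pairs[of x])
qed


lemma prox_U:
  assumes x: "x \<in> carrier ell2" and "\<gamma> > 0"
  shows "prox ell2 \<gamma> (indicator_fn U) x = PU x"
proof (rule ell2.prox_indicator_eq[OF _ PU_in_U[OF x] x \<open>\<gamma> > 0\<close>])
  show "U \<subseteq> carrier ell2" by (auto simp: U_def)
  fix y assume y: "y \<in> U"
  have pH: "PU x \<in> carrier ell2" and yH: "y \<in> carrier ell2"
    using y PU_in_U[OF x] by (auto simp: U_def)
  show "inner_prod ell2 (y \<ominus>\<^bsub>ell2\<^esub> PU x) (x \<ominus>\<^bsub>ell2\<^esub> PU x) = 0"
    using x y pH yH
    by (subst inner_prod_ell2_pairs) (auto simp: U_def pair_maps_simps intro!: summable_square_diff)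
qed

lemma prox_V:
  assumes x: "x \<in> carrier ell2" and "\<gamma> > 0"
  shows "prox ell2 \<gamma> (indicator_fn V) x = PV x"
proof (rule ell2.prox_indicator_eq[OF _ PV_in_V[OF x] x \<open>\<gamma> > 0\<close>])
  show "V \<subseteq> carrier ell2" by (auto simp: V_def)
  fix y assume y: "y \<in> V"
  have pH: "PV x \<in> carrier ell2" and yH: "y \<in> carrier ell2"
    using y PV_in_V[OF x] by (auto simp: V_def)
  let ?d = "\<lambda>n. y n - PV x n" and ?e = "\<lambda>n. x n - PV x n"
  have "?d (2*i) * ?e (2*i) + ?d (2*i+1) * ?e (2*i+1) = 0" for i
  proof -
    have "s i * y (2*i) = c i * y (Suc (2*i))"
      using y by (simp add: V_def)
    \<comment> \<open>The vector \<open>?d\<close> lies along the line of \<open>V\<close>, and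
      \<open>?e\<close> is normal to it.\<close>
    then have "s i * ?d (2*i) = c i * ?d (2*i+1)"
      unfolding pair_maps_simps Suc_eq_plus1[symmetric] by Groebner_Basis.algebra
    moreover have "c i * ?e (2*i) + s i * ?e (2*i+1) = 0"
      using unit[of i] unfolding pair_maps_simps Suc_eq_plus1[symmetric] by Groebner_Basis.algebra
    ultimately show ?thesis using unit[of i] by Groebner_Basis.algebra
  qed
  then show "inner_prod ell2 (y \<ominus>\<^bsub>ell2\<^esub> PV x) (x \<ominus>\<^bsub>ell2\<^esub> PV x) = 0"
    using x pH yH by (subst inner_prod_ell2_pairs) (auto intro!: summable_square_diff)
qed

text \<open>In each plane, reflecting in the line of \<open>U\<close> and then in that of
  \<open>V\<close> rotates by 2\<theta>, where \<theta> is the angle with cosine \<open>c i\<close>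
  and sine \<open>s i\<close>. The mean of this rotation and the identity is cos \<theta> times the
  rotation by \<theta>.\<close>

lemma half_averaged_T_PRS:
  assumes x: "x \<in> carrier ell2" and \<gamma>: "\<gamma> > 0"
  shows "half_averaged ell2 (T_PRS ell2 \<gamma> (indicator_fn V) (indicator_fn U)) x = step x"
    and "step x \<in> carrier ell2"
proof -
  let ?r = "\<lambda>n. 2 * PU x n - x n"
  have "PU x \<in> carrier ell2" using PU_in_U[OF x] by (simp add: U_def)
  then have rH: "?r \<in> carrier ell2"
    using x by (auto intro!: summable_square_diff summable_square_cmult)
  let ?q = "\<lambda>n. 2 * PV ?r n - ?r n"
  have "PV ?r \<in> carrier ell2" using PV_in_V[OF rH] by (simp add: V_def)
  then have qH: "?q \<in> carrier ell2"
    using rH by (auto intro!: summable_square_diff summable_square_cmult)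
  have eq: "(\<lambda>n. 1/2 * (x n + ?q n)) = step x"
  proof (rule pairs_eqI)
    fix i
    show "1/2 * (x (2*i) + ?q (2*i)) = step x (2*i)"
      unfolding pair_maps_simps by (simp add: algebra_simps)
    let ?a = "x (2*i)" and ?b = "x (Suc (2*i))"
    have "s i * (c i * ?a - s i * ?b) + ?b = c i * (s i * ?a + c i * ?b)"
      using unit[of i] by Groebner_Basis.algebra
    then show "1/2 * (x (Suc (2*i)) + ?q (Suc (2*i))) = step x (Suc (2*i))"
      unfolding pair_maps_simps by (simp add: algebra_simps)
  qed
  show "step x \<in> carrier ell2"
    unfolding eq[symmetric]
    using x qH unfolding ell2_simps
    by (intro summable_square_cmult summable_square_add)
  show "half_averaged ell2 (T_PRS ell2 \<gamma> (indicator_fn V) (indicator_fn U)) x = step x"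
    by (simp only: half_averaged_def T_PRS_def prox_refl_def comp_apply prox_U[OF x \<gamma>]
        prox_V[OF rH \<gamma>] ell2_minus[OF x] ell2_minus[OF rH] ell2_simps(3,4) eq)
qed

section \<open>Squared norms of the plane components along the iteration\<close>

definition energy :: "(nat \<Rightarrow> real) \<Rightarrow> nat \<Rightarrow> real" where
  "energy x i = (x (2*i))\<^sup>2 + (x (2*i+1))\<^sup>2"

lemma energy_step: "energy (step x) i = (c i)\<^sup>2 * energy x i"
proof -
  have "energy (step x) i = (c i)\<^sup>2 * (((c i)\<^sup>2 + (s i)\<^sup>2) * energy x i)"
    unfolding energy_def pair_maps_simps Suc_eq_plus1[symmetric] by Groebner_Basis.algebra
  then show ?thesis by (simp add: unit)
qed

text \<open>In complex notation, cos \<theta> exp(i\<theta>) - 1 = i sin \<theta> exp(i\<theta>),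
  which has modulus |sin \<theta>|.\<close>

lemma energy_step_diff: "energy (\<lambda>n. step x n - x n) i = (s i)\<^sup>2 * energy x i"
  using unit[of i] unfolding energy_def pair_maps_simps Suc_eq_plus1[symmetric] by Groebner_Basis.algebra

text \<open>Each step multiplies the energy of the \<open>i\<close>-th plane by
  \<open>(c i)\<^sup>2\<close>, and the residual is bounded below by its component in that plane
  alone.\<close>

lemma residual_ge:
  assumes z0: "z 0 \<in> carrier ell2" and \<gamma>: "\<gamma> > 0"
    and T: "T = half_averaged ell2 (T_PRS ell2 \<gamma> (indicator_fn V) (indicator_fn U))"
    and z: "\<And>k. z (Suc k) = T (z k)"
  shows "(s i)\<^sup>2 * ((c i)\<^sup>2) ^ k * energy (z 0) i \<le> (hnorm ell2 (T (z k) \<ominus>\<^bsub>ell2\<^esub> z k))\<^sup>2"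
proof -
  have inv: "z k \<in> carrier ell2 \<and> energy (z k) i = ((c i)\<^sup>2) ^ k * energy (z 0) i" for k
    by (induction k) (auto simp: z0[simplified] z T half_averaged_T_PRS[OF _ \<gamma>, simplified] energy_step)
  have zk: "z k \<in> carrier ell2" using inv by blast
  have Tz: "T (z k) = step (z k)" unfolding T by (rule half_averaged_T_PRS[OF zk \<gamma>])
  have d: "(\<lambda>n. step (z k) n - z k n) \<in> carrier ell2"
    using zk half_averaged_T_PRS(2)[OF zk \<gamma>] by (simp add: summable_square_diff)
  have "(s i)\<^sup>2 * ((c i)\<^sup>2) ^ k * energy (z 0) i = energy (\<lambda>n. step (z k) n - z k n) i"
    by (simp add: energy_step_diff inv[THEN conjunct2, of k])
  also have "\<dots> = (\<Sum>n\<in>{2*i,2*i+1}. (step (z k) n - z k n)\<^sup>2)"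
    by (simp add: energy_def)
  also have "\<dots> \<le> (hnorm ell2 (T (z k) \<ominus>\<^bsub>ell2\<^esub> z k))\<^sup>2"
    using sum_le_hnorm_ell2[OF d, of "{2*i,2*i+1}"] zk Tz by simp
  finally show ?thesis .
qed

end

text \<open>Bernoulli at exponent \<open>2 * m\<close> would only give 0. At exponent
  \<open>m\<close> it gives 1/2, and squaring reaches \<open>2 * m\<close>.\<close>

lemma power_one_minus_inverse_ge:
  assumes "0 < m" "k \<le> 2 * m"
  shows "1 / 4 \<le> (1 - 1 / (2 * real m)) ^ k"
proof -
  let ?x = "1 - 1 / (2 * real m)"
  have x: "0 \<le> ?x" "?x \<le> 1" using assms by (auto simp: field_simps)
  have "1 / 2 \<le> ?x ^ m"
    using Bernoulli_inequality[of "- (1 / (2 * real m))" m] assms by (simp add: field_simps)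
  then have "(1 / 2)\<^sup>2 \<le> (?x ^ m)\<^sup>2" by (intro power_mono) auto
  also have "\<dots> = ?x ^ (2 * m)" by (simp add: power_mult[symmetric] mult.commute)
  also have "\<dots> \<le> ?x ^ k" using x assms by (intro power_decreasing) auto
  finally show ?thesis by (simp add: power2_eq_square)
qed

section \<open>Choice of the angles and of the starting point\<close>

theorem theorem8:
  shows "\<exists>(H :: (nat \<Rightarrow> real) inner_space) U V.
    hilbert_space H \<and> closed_subspace H U \<and> closed_subspace H V \<and> U \<inter> V = {\<zero>\<^bsub>H\<^esub>} \<and>
    (\<forall>\<alpha>::real. \<alpha> > 1 / 2 \<longrightarrow>
      (\<exists>z0 \<in> carrier H. \<forall>\<gamma>::real. \<gamma> > 0 \<longrightarrow>
        (let T = half_averaged H (T_PRS H \<gamma> (indicator_fn V) (indicator_fn U)) in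
          \<forall>z :: nat \<Rightarrow> (nat \<Rightarrow> real).
            z 0 = z0 \<and> (\<forall>k. z (Suc k) = T (z k)) \<longrightarrow>
            (\<forall>k\<ge>1. (hnorm H (T (z k) \<ominus>\<^bsub>H\<^esub> z k))\<^sup>2 \<ge> 1 / (real k + 1) powr (2 * \<alpha>)))))"
proof -
  \<comment> \<open>The exponent \<open>Suc i\<close> gives \<open>(c i)\<^sup>2\<close> the form
    \<open>1 - 1 / (2 * m)\<close> with \<open>m = 2 ^ i\<close>, to which the power estimate
    applies.\<close>
  define s c :: "nat \<Rightarrow> real" where
    "s i = sqrt (1 / 2 ^ Suc i)" and "c i = sqrt (1 - 1 / 2 ^ Suc i)" for i
  have le1: "1 / 2 ^ Suc i \<le> (1::real)" for i
    by (simp add: one_le_power del: power_Suc)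
  have s2: "(s i)\<^sup>2 = 1 / 2 ^ Suc i" for i
    unfolding s_def by (rule real_sqrt_pow2) simp
  have c2: "(c i)\<^sup>2 = 1 - 1 / 2 ^ Suc i" for i
    unfolding c_def using le1[of i] by (intro real_sqrt_pow2) linarith
  interpret plane_lines c s
    by unfold_locales (simp add: s2 c2)
  have "s i \<noteq> 0" for i by (simp add: s_def)
  note UV = U_Int_V[OF this]
  have main: "\<exists>z0 \<in> carrier ell2. \<forall>\<gamma>::real. \<gamma> > 0 \<longrightarrow>
        (let T = half_averaged ell2 (T_PRS ell2 \<gamma> (indicator_fn V) (indicator_fn U)) in
          \<forall>z :: nat \<Rightarrow> (nat \<Rightarrow> real).
            z 0 = z0 \<and> (\<forall>k. z (Suc k) = T (z k)) \<longrightarrow>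
            (\<forall>k\<ge>1. (hnorm ell2 (T (z k) \<ominus>\<^bsub>ell2\<^esub> z k))\<^sup>2 \<ge> 1 / (real k + 1) powr (2 * \<alpha>)))"
    if \<alpha>: "\<alpha> > 1 / 2" for \<alpha> :: real
  proof -
    \<comment> \<open>The square of the entry at \<open>2 * i\<close> is a multiple of \<open>b ^ (4 * i)\<close>, hence the exponent's denominator 4.\<close>
    define b where "b = 2 powr ((1 - 2 * \<alpha>) / 4)"
    \<comment> \<open>The square of \<open>sqrt 8\<close> is 2 * 4: the 2 offsets the extra halving
      in \<open>(s i)\<^sup>2\<close>, the 4 offsets the bound 1/4 on the power of
      \<open>(c i)\<^sup>2\<close>. A geometric sequence makes square-summability immediate.\<close>
    define z0 where "z0 n = sqrt 8 * b ^ n" for n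
    \<comment> \<open>Here \<alpha> > 1/2 enters: it makes the exponent negative and so the
      geometric series convergent.\<close>
    have b: "0 < b" "b < 1" using \<alpha> powr_less_mono[of "(1 - 2 * \<alpha>) / 4" 0 2] by (auto simp: b_def)
    have z0sq: "(z0 n)\<^sup>2 = 8 * (b\<^sup>2) ^ n" for n
      by (simp add: z0_def power_mult_distrib power_mult[symmetric] mult.commute)
    have "b\<^sup>2 < 1" using b by (simp add: power_less_one_iff)
    then have z0H: "z0 \<in> carrier ell2"
      using b by (auto simp: z0sq intro!: summable_mult summable_geometric)
    have energy_ge: "8 * (2 ^ i) powr (1 - 2 * \<alpha>) \<le> energy z0 i" for i
    proof -
      have "(z0 (2*i))\<^sup>2 = 8 * b ^ (4 * i)"
        by (simp add: z0sq power_mult[symmetric])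
      also have "b ^ (4 * i) = b powr (4 * real i)"
        using powr_realpow[OF b(1), of "4 * i"] by simp
      also have "\<dots> = (2 powr real i) powr (1 - 2 * \<alpha>)"
        by (simp add: b_def powr_powr mult.commute)
      also have "2 powr real i = 2 ^ i"
        by (simp add: powr_realpow)
      finally show ?thesis by (simp add: energy_def)
    qed
    have "1 / (real k + 1) powr (2 * \<alpha>) \<le> (hnorm ell2 (T (z k) \<ominus>\<^bsub>ell2\<^esub> z k))\<^sup>2"
      if \<gamma>: "\<gamma> > 0" and T: "T = half_averaged ell2 (T_PRS ell2 \<gamma> (indicator_fn V) (indicator_fn U))"
        and zz: "z 0 = z0" and z: "\<And>k. z (Suc k) = T (z k)" for \<gamma> T z k
    proof -
      \<comment> \<open>The plane is matched to the dyadic scale of \<open>k + 1\<close>: the lower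
        bound on \<open>k + 1\<close> compares the powers of \<open>k + 1\<close> and
        \<open>2 ^ i\<close>, the upper one gives \<open>k \<le> 2 * 2 ^ i\<close> for the power
        estimate.\<close>
      have "\<exists>i. 2 ^ i \<le> k + 1 \<and> k + 1 < 2 ^ (i + 1)"
        by (rule ex_power_ivl1) simp_all
      then obtain i where i: "2 ^ i \<le> k + 1" "k + 1 < 2 ^ (i + 1)"
        by blast
      have ik: "(2::real) ^ i \<le> real k + 1"
        using i(1) by (metis of_nat_1 of_nat_add of_nat_le_iff of_nat_numeral of_nat_power)
      have "1 / (real k + 1) powr (2 * \<alpha>) \<le> 1 / (2 ^ i) powr (2 * \<alpha>)"
        using ik \<alpha> by (intro divide_left_mono powr_mono2) auto
      \<comment> \<open>The constants cancel exactly: the first two factors and 8 multiply to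
        \<open>1 / 2 ^ i\<close>, which lowers the exponent \<open>1 - 2 * \<alpha>\<close> to
        \<open>- 2 * \<alpha>\<close>.\<close>
      also have "\<dots> = (s i)\<^sup>2 * (1 / 4) * (8 * (2 ^ i) powr (1 - 2 * \<alpha>))"
        by (simp add: s2 powr_diff)
      also have "\<dots> \<le> (s i)\<^sup>2 * ((c i)\<^sup>2) ^ k * energy z0 i"
      proof (intro mult_mono mult_left_mono energy_ge)
        show "1 / 4 \<le> ((c i)\<^sup>2) ^ k"
          using power_one_minus_inverse_ge[of "2 ^ i" k] i by (simp add: c2)
      qed (auto simp: c2 le1 simp del: power_Suc)
      also have "\<dots> \<le> (hnorm ell2 (T (z k) \<ominus>\<^bsub>ell2\<^esub> z k))\<^sup>2"
        using residual_ge[of z, OF _ \<gamma> T z, of i k] z0H zz by simp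
      finally show ?thesis .
    qed
    then show ?thesis
      unfolding Let_def using z0H by blast
  qed
  show ?thesis
    using hilbert_space_ell2 closed_subspace_U closed_subspace_V UV main by blast
qed

end
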